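(* Let $c_{\mathrm{sub}}$ be the limsup of $\gamma(G)/\rho(G)$ over connected subcubic graphs $G$ as $\rho(G)\to\infty$, and let $c_{\mathrm{cub}}$ be the limsup of $\gamma(G)/\rho(G)$ over connected cubic graphs $G$ as $\rho(G)\to\infty$. Then $$c_{\mathrm{sub}}\geq\frac{13}{6},\qquad c_{\mathrm{cub}}\geq\frac{17}{8}.$$
   Context: All graphs are finite, simple and undirected. A graph is subcubic if its maximum degree is at most $3$, and cubic if every vertex has degree exactly $3$. $\gamma(G)$ is the domination number: the minimum size of a set $D\subseteq V(G)$ meeting every closed neighborhood $N_G[v]$, $v\in V(G)$. $\rho(G)$ is the packing number: the maximum size of a set $P\subseteq V(G)$ whose distinct elements are pairwise at distance at least $3$ in $G$. For a class $\mathcal C$ of graphs, the limsup of $\gamma(G)/\rho(G)$ over $G\in\mathcal C$ as $\rho(G)\to\infty$ means $\inf_{k\ge 1}\,\sup\{\gamma(G)/\rho(G): G\in\mathcal C,\ \rho(G)\ge k\}$. *)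

theory Defs
  imports "Graph_Theory.Graph_Theory"
begin

text \<open>
  Finite simple undirected graphs are the locale \<^locale>\<open>pair_graph\<close>: finite, loopfree,
  symmetric arc relation without parallel arcs. An edge \<open>uv\<close> is the pair of arcs
  \<open>(u,v)\<close>, \<open>(v,u)\<close>, so the degree of a vertex is its \<^const>\<open>out_degree\<close>.
\<close>

definition subcubic :: "'a pair_pre_digraph \<Rightarrow> bool" where
  "subcubic G \<longleftrightarrow> (\<forall>v \<in> pverts G. out_degree (with_proj G) v \<le> 3)"

definition cubic :: "'a pair_pre_digraph \<Rightarrow> bool" where
  "cubic G \<longleftrightarrow> (\<forall>v \<in> pverts G. out_degree (with_proj G) v = 3)"

definition closed_nbhd :: "'a pair_pre_digraph \<Rightarrow> 'a \<Rightarrow> 'a set" where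
  "closed_nbhd G v = insert v {u. (v, u) \<in> parcs G}"

definition dominating :: "'a pair_pre_digraph \<Rightarrow> 'a set \<Rightarrow> bool" where
  "dominating G D \<longleftrightarrow> D \<subseteq> pverts G \<and> (\<forall>v \<in> pverts G. D \<inter> closed_nbhd G v \<noteq> {})"

definition domination_number :: "'a pair_pre_digraph \<Rightarrow> nat" where
  "domination_number G = Min {card D | D. dominating G D}"

text \<open>With all weights 1, the shortest-path weight of the library is the graph distance; it is
  infinite between different components.\<close>

definition graph_dist :: "'a pair_pre_digraph \<Rightarrow> 'a \<Rightarrow> 'a \<Rightarrow> ereal" where
  "graph_dist G u v = wf_digraph.\<mu> (with_proj G) (\<lambda>_. 1) u v"

definition packing :: "'a pair_pre_digraph \<Rightarrow> 'a set \<Rightarrow> bool" where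
  "packing G P \<longleftrightarrow> P \<subseteq> pverts G \<and>
     (\<forall>u \<in> P. \<forall>v \<in> P. u \<noteq> v \<longrightarrow> 3 \<le> graph_dist G u v)"

definition packing_number :: "'a pair_pre_digraph \<Rightarrow> nat" where
  "packing_number G = Max {card P | P. packing G P}"

text \<open>The infimum and suprema are taken in \<^typ>\<open>ereal\<close>, so that they exist without any
  boundedness assumption.\<close>

definition limsup_ratio :: "'a pair_pre_digraph set \<Rightarrow> ereal" where
  "limsup_ratio C =
     (INF k \<in> {1::nat..}. SUP G \<in> {G \<in> C. k \<le> packing_number G}.
        ereal (real (domination_number G) / real (packing_number G)))"

text \<open>Vertices are natural numbers: every finite graph is isomorphic to such a graph.
  (\<^const>\<open>Digraph_Component.connected\<close> excludes the null graph, which has packing number 0 and hence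
  plays no role in the limsup.)\<close>

definition connected_subcubic_graphs :: "nat pair_pre_digraph set" where
  "connected_subcubic_graphs =
     {G. pair_graph G \<and> Digraph_Component.connected (with_proj G) \<and> subcubic G}"

definition connected_cubic_graphs :: "nat pair_pre_digraph set" where
  "connected_cubic_graphs =
     {G. pair_graph G \<and> Digraph_Component.connected (with_proj G) \<and> cubic G}"

definition c_sub :: ereal where
  "c_sub = limsup_ratio connected_subcubic_graphs"

definition c_cub :: ereal where
  "c_cub = limsup_ratio connected_cubic_graphs"

end

theory Submission
  imports Defs "HOL-Library.Nat_Bijection"
begin

text \<open>
  A packing has at most one vertex in every set whose vertices are pairwise at distance at most
  two, and a dominating set has at least \<open>g\<close> vertices in every set \<open>S\<close> that contains the closed
  neighbourhoods of some vertices which no \<open>g - 1\<close> vertices of \<open>S\<close> dominate. Both bounds are local.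
  So it suffices to find one finite \<^emph>\<open>unit\<close> that can be covered by \<open>p\<close> sets of the first kind and
  contains disjoint sets of the second kind whose demands \<open>g\<close> add up to \<open>d\<close>: \<open>k\<close> copies of the unit,
  joined in a ring, have packing number at most \<open>k p\<close> and domination number at least \<open>k d\<close>. The
  packing number is also at least \<open>k\<close>, hence the limsup of the ratio is at least \<open>d / p\<close>
  (\<open>limsup_ratio_necklaces\<close>). The units have \<open>(d, p) = (13, 6)\<close> and \<open>(17, 8)\<close>.

  The gain over the ratio 2 comes from the Wagner graph, an 8-cycle with its four long diagonals,
  which has diameter two and domination number three. After one of its diagonals is subdivided by a
  new vertex \<open>w\<close>, which serves to attach it, the eight old vertices are still pairwise at distance at most two, and
  three vertices are still needed to dominate them, whatever happens outside. Only the attachment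
  vertices \<open>w\<close> have to be paid for in the packing. If two of these blocks hang at a common vertex \<open>h\<close>,
  then the closed neighbourhood of \<open>h\<close> covers both vertices \<open>w\<close> and one further neighbour: the demand
  is 6 and three sets cover the blocks together with \<open>h\<close>. What remains is to connect such pairs
  cheaply.

  Both units contain the graph \<open>K\<close> obtained from \<open>K\<^sub>4\<close> by subdividing the three edges at one vertex. It
  has diameter two, and two vertices are needed to dominate the four vertices of the \<open>K\<^sub>4\<close>. Two of its subdividing vertices link consecutive units, and the rest
  of the unit hangs at the third one.

  \<^item> In the subcubic unit, a vertex \<open>r\<close> is attached there. It has a neighbour \<open>u\<close> of degree two, which
    leads to the vertex \<open>h\<close> of a pair of blocks, and a neighbour \<open>v\<close>, which carries a leaf \<open>l\<close> and a
    third block. The vertices \<open>u\<close> and \<open>l\<close> have disjoint closed neighbourhoods outside the blocks, so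
    the total demand is \<open>2 + 9 + 1 + 1 = 13\<close>. The cover consists of \<open>K\<close>, the three blocks without
    their attachment vertices, and the closed neighbourhoods of \<open>h\<close> and \<open>v\<close>: six sets.

  \<^item> In the cubic unit, the graph \<open>M\<close> obtained from \<open>K\<^sub>3\<^sub>,\<^sub>3\<close> by subdividing the edges of a perfect
    matching is attached there by one of its subdividing vertices, and each of the other two carries
    a pair of blocks. Dominating \<open>M\<close> except for the first subdividing vertex takes three vertices, so
    the total demand is \<open>2 + 3 + 12 = 17\<close>. The closed neighbourhoods of the two vertices \<open>h\<close> also
    cover two vertices of \<open>M\<close>, and the other seven are pairwise at distance at most two. So the cover
    has \<open>1 + 1 + 2 + 4 = 8\<close> sets.
\<close>

section \<open>Packings as disjoint closed neighbourhoods\<close>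

lemma graph_dist_ge_3_iff:
  assumes "pair_graph G" "u \<in> pverts G" "v \<in> pverts G" "u \<noteq> v"
  shows "3 \<le> graph_dist G u v \<longleftrightarrow> closed_nbhd G u \<inter> closed_nbhd G v = {}"
proof -
  interpret pair_graph G by fact
  have cost: "awalk_cost (\<lambda>_. 1) p = real (length p)" for p
    by (induction p) auto
  have mu: "graph_dist G u v = (INF p \<in> {p. awalk u p v}. ereal (real (length p)))"
    by (simp add: graph_dist_def \<mu>_def cost)
  have walk: "closed_nbhd G u \<inter> closed_nbhd G v \<noteq> {} \<longleftrightarrow> (\<exists>p. awalk u p v \<and> length p < 3)"
  proof
    assume "closed_nbhd G u \<inter> closed_nbhd G v \<noteq> {}"
    then consider "(u, v) \<in> parcs G" | x where "(u, x) \<in> parcs G" "(x, v) \<in> parcs G"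
      using assms(4) by (auto simp: closed_nbhd_def intro: arcs_symmetric)
    then show "\<exists>p. awalk u p v \<and> length p < 3"
    proof cases
      case 1
      then have "awalk u [(u, v)] v" using assms by (simp add: awalk_def)
      then show ?thesis by force
    next
      case 2
      then have "awalk u [(u, x), (x, v)] v" using assms by (simp add: awalk_def)
      then show ?thesis by force
    qed
  next
    assume "\<exists>p. awalk u p v \<and> length p < 3"
    then obtain p where p: "awalk u p v" "length p < 3" by blast
    then consider "p = []" | e where "p = [e]" | e f where "p = [e, f]"
      by (cases p; cases "tl p"; cases "tl (tl p)") auto
    then show "closed_nbhd G u \<inter> closed_nbhd G v \<noteq> {}"
    proof cases
      case 1
      then show ?thesis using p assms by (simp add: awalk_def)
    next
      case 2
      then have "(u, v) \<in> parcs G" using p by (cases e) (auto simp: awalk_def)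
      then show ?thesis by (auto simp: closed_nbhd_def)
    next
      case 3
      then have "(u, snd e) \<in> parcs G" "(snd e, v) \<in> parcs G"
        using p by (cases e; cases f; auto simp: awalk_def)+
      then show ?thesis by (auto simp: closed_nbhd_def dest: arcs_symmetric)
    qed
  qed
  have "3 \<le> graph_dist G u v \<longleftrightarrow> (\<forall>p. awalk u p v \<longrightarrow> 3 \<le> length p)"
    by (auto simp: mu le_INF_iff)
  with walk show ?thesis by (meson not_less)
qed

lemma packing_iff:
  assumes "pair_graph G"
  shows "packing G P \<longleftrightarrow> P \<subseteq> pverts G \<and>
    (\<forall>u \<in> P. \<forall>v \<in> P. u \<noteq> v \<longrightarrow> closed_nbhd G u \<inter> closed_nbhd G v = {})"
  using graph_dist_ge_3_iff[OF assms] unfolding packing_def by (meson subsetD)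

lemma domination_number_geI:
  assumes "pair_graph G" "\<And>D. dominating G D \<Longrightarrow> n \<le> card D"
  shows "n \<le> domination_number G"
proof -
  interpret pair_graph G by fact
  have "{card D | D. dominating G D} \<subseteq> card ` Pow (pverts G)"
    by (auto simp: dominating_def)
  then have "finite {card D | D. dominating G D}"
    using pair_finite_verts by (meson finite_Pow_iff finite_imageI finite_subset)
  moreover have "dominating G (pverts G)"
    by (auto simp: dominating_def closed_nbhd_def)
  ultimately show ?thesis
    unfolding domination_number_def using assms(2) by (subst Min_ge_iff) auto
qed

lemma finite_packing_cards:
  assumes "pair_graph G"
  shows "finite {card P | P. packing G P}"
proof -
  interpret pair_graph G by fact
  have "{card P | P. packing G P} \<subseteq> card ` Pow (pverts G)"
    by (auto simp: packing_def)
  then show ?thesis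
    using pair_finite_verts by (meson finite_Pow_iff finite_imageI finite_subset)
qed

lemma packing_number_geI:
  assumes "pair_graph G" "packing G P"
  shows "card P \<le> packing_number G"
  unfolding packing_number_def
  using finite_packing_cards[OF assms(1)] assms(2) by (intro Max_ge) auto

lemma packing_number_leI:
  assumes "pair_graph G" "\<And>P. packing G P \<Longrightarrow> card P \<le> n"
  shows "packing_number G \<le> n"
proof -
  have "packing G {}" by (simp add: packing_def)
  then show ?thesis
    unfolding packing_number_def using finite_packing_cards[OF assms(1)] assms(2)
    by (subst Max_le_iff) auto
qed

lemma limsup_ratio_geI:
  fixes c :: real
  assumes "\<And>n. \<exists>G \<in> C. n \<le> packing_number G \<and>
             c * real (packing_number G) \<le> real (domination_number G)"
  shows "ereal c \<le> limsup_ratio C"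
  unfolding limsup_ratio_def
proof (rule INF_greatest)
  fix n :: nat assume "n \<in> {1..}"
  obtain G where G: "G \<in> C" "n \<le> packing_number G"
      "c * real (packing_number G) \<le> real (domination_number G)"
    using assms by blast
  have "ereal c \<le> ereal (real (domination_number G) / real (packing_number G))"
    using G \<open>n \<in> {1..}\<close> by (simp add: le_divide_eq)
  with G show "ereal c \<le> (SUP G \<in> {G \<in> C. n \<le> packing_number G}.
      ereal (real (domination_number G) / real (packing_number G)))"
    by (intro SUP_upper2[of G]) auto
qed

section \<open>Necklaces\<close>

text \<open>
  Lists with repetition of length exactly \<open>n\<close> enumerate the candidates for a dominating set of size
  at most \<open>n\<close>, which makes the demand of a block a finite check by rewriting.
\<close>

lemma subset_n_lists:
  assumes "A \<subseteq> set S" "card A \<le> n" "S \<noteq> []"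
  shows "\<exists>xs \<in> set (List.n_lists n S). A \<subseteq> set xs"
proof -
  obtain ys where ys: "set ys = A" "length ys = card A"
    using finite_distinct_list[of A] assms(1) by (metis distinct_card finite_set finite_subset)
  let ?xs = "ys @ replicate (n - card A) (hd S)"
  have "length ?xs = n" "set ?xs \<subseteq> set S" "A \<subseteq> set ?xs"
    using ys assms by auto
  then show ?thesis by (metis (mono_tags, lifting) mem_Collect_eq set_n_lists)
qed

lemma sum_card_distinct_concat:
  assumes "distinct (concat (map f bs))"
  shows "(\<Sum>b \<leftarrow> bs. card (T \<inter> set (f b))) = card (T \<inter> set (concat (map f bs)))"
  using assms
proof (induction bs)
  case (Cons b bs)
  then have "card (T \<inter> set (f b) \<union> T \<inter> set (concat (map f bs)))
      = card (T \<inter> set (f b)) + card (T \<inter> set (concat (map f bs)))"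
    by (intro card_Un_disjoint) auto
  with Cons show ?case by (simp add: Int_Un_distrib)
qed simp

text \<open>
  A unit is given by its adjacency lists. Its vertices \<open>0\<close> and \<open>a\<close> are the ports at which
  consecutive copies are linked. A numbering in which every vertex other than \<open>0\<close> has a smaller
  neighbour reduces connectedness of the ring to a descent along vertex numbers and copies. The
  condition \<open>1 < a\<close> makes the vertex \<open>1\<close> an inner one: its closed neighbourhood stays in its copy, so
  that the copies of \<open>1\<close> form a packing.
\<close>

locale unit_graph =
  fixes U :: "nat list list" and a :: nat
  assumes simple: "\<forall>j < length U. \<forall>v \<in> set (U ! j). v < length U \<and> v \<noteq> j \<and> j \<in> set (U ! v)"
    and descent: "\<forall>j < length U. 0 < j \<longrightarrow> (\<exists>v \<in> set (U ! j). v < j)"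
    and port: "1 < a" "a < length U"
begin

text \<open>
  The vertex \<open>(i, j)\<close> is the vertex \<open>j\<close> of the copy \<open>i\<close>. The ring is closed up, so that no copy has a
  free port and cubic units give cubic graphs.
\<close>

definition nbrs :: "nat \<Rightarrow> nat \<times> nat \<Rightarrow> (nat \<times> nat) set" where
  "nbrs k x = (case x of (i, j) \<Rightarrow>
     Pair i ` set (U ! j)
     \<union> (if j = 0 then {(if i = 0 then k - 1 else i - 1, a)} else {})
     \<union> (if j = a then {(if Suc i = k then 0 else Suc i, 0)} else {}))"

definition cells :: "nat \<Rightarrow> (nat \<times> nat) set" where
  "cells k = {..<k} \<times> {..<length U}"

definition necklace :: "nat \<Rightarrow> nat pair_pre_digraph" where
  "necklace k = \<lparr> pverts = prod_encode ` cells k,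
     parcs = {(prod_encode x, prod_encode y) | x y. x \<in> cells k \<and> y \<in> nbrs k x} \<rparr>"

lemma pverts_necklace: "pverts (necklace k) = prod_encode ` cells k"
  by (simp add: necklace_def)

lemma arc_necklace:
  "(prod_encode x, prod_encode y) \<in> parcs (necklace k) \<longleftrightarrow> x \<in> cells k \<and> y \<in> nbrs k x"
  by (cases x; cases y) (auto simp: necklace_def)

lemma arc_necklaceE:
  assumes "e \<in> parcs (necklace k)"
  obtains x y where "e = (prod_encode x, prod_encode y)" "x \<in> cells k" "y \<in> nbrs k x"
  using assms that unfolding necklace_def pair_pre_digraph.select_convs by blast

lemma nbrs_sym:
  assumes "x \<in> cells k" "y \<in> nbrs k x"
  shows "y \<in> cells k \<and> x \<in> nbrs k y \<and> x \<noteq> y"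
proof -
  obtain i j i' j' where xy: "x = (i, j)" "y = (i', j')" by (cases x; cases y)
  have ij: "i < k" "j < length U" using assms(1) xy by (auto simp: cells_def)
  from assms(2) xy consider
      "i' = i" "j' \<in> set (U ! j)"
    | "j = 0" "j' = a" "i' = (if i = 0 then k - 1 else i - 1)"
    | "j = a" "j' = 0" "i' = (if Suc i = k then 0 else Suc i)"
    by (auto simp: nbrs_def split: if_splits)
  then show ?thesis
  proof cases
    case 1
    with simple ij have "j' < length U" "j' \<noteq> j" "j \<in> set (U ! j')" by blast+
    with 1 ij show ?thesis by (simp add: xy cells_def nbrs_def)
  next
    case 2
    with ij port show ?thesis by (auto simp: xy cells_def nbrs_def)
  next
    case 3
    with ij port show ?thesis by (auto simp: xy cells_def nbrs_def)
  qed
qed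

lemma pair_graph_necklace: "pair_graph (necklace k)"
proof
  have ends: "fst e \<in> pverts (necklace k) \<and> snd e \<in> pverts (necklace k) \<and> fst e \<noteq> snd e
      \<and> (snd e, fst e) \<in> parcs (necklace k)" if e: "e \<in> parcs (necklace k)" for e
  proof -
    obtain x y where "e = (prod_encode x, prod_encode y)" "x \<in> cells k" "y \<in> nbrs k x"
      using e by (rule arc_necklaceE)
    with nbrs_sym[of x k y] show ?thesis
      by (simp add: pverts_necklace arc_necklace)
  qed
  show fin: "finite (pverts (necklace k))"
    by (simp add: pverts_necklace cells_def)
  have "parcs (necklace k) \<subseteq> pverts (necklace k) \<times> pverts (necklace k)"
  proof
    fix e assume "e \<in> parcs (necklace k)"
    from ends[OF this] show "e \<in> pverts (necklace k) \<times> pverts (necklace k)"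
      by (simp add: mem_Times_iff)
  qed
  then show "finite (parcs (necklace k))"
    using fin by (meson finite_SigmaI finite_subset)
  show "symmetric (with_proj (necklace k))"
    unfolding symmetric_def with_proj_simps by (rule symI) (use ends in fastforce)
  fix e assume "e \<in> parcs (necklace k)"
  then show "fst e \<in> pverts (necklace k)" "snd e \<in> pverts (necklace k)" "fst e \<noteq> snd e"
    using ends[of e] by simp_all
qed

text \<open>
  With at least two copies the link at a port leads to a different copy, so it is never parallel to
  an edge inside the unit.
\<close>

lemma out_degree_necklace:
  assumes "i < k" "j < length U" "2 \<le> k"
  shows "out_degree (with_proj (necklace k)) (prod_encode (i, j))
       = card (set (U ! j)) + of_bool (j = 0) + of_bool (j = a)"
proof -
  have "out_arcs (with_proj (necklace k)) (prod_encode (i, j))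
      = (\<lambda>y. (prod_encode (i, j), prod_encode y)) ` nbrs k (i, j)"
    using assms by (auto simp: out_arcs_def necklace_def cells_def)
  then have "out_degree (with_proj (necklace k)) (prod_encode (i, j)) = card (nbrs k (i, j))"
    by (simp add: out_degree_def card_image inj_on_def)
  also have "\<dots> = card (set (U ! j)) + of_bool (j = 0) + of_bool (j = a)"
  proof -
    have "card (Pair i ` set (U ! j)) = card (set (U ! j))"
      by (simp add: card_image inj_on_def)
    then show ?thesis
      using assms port by (auto simp: nbrs_def card_insert_if split: if_splits)
  qed
  finally show ?thesis .
qed

lemma connected_necklace:
  assumes "0 < k"
  shows "Digraph_Component.connected (with_proj (necklace k))"
proof -
  interpret pair_graph "necklace k" by (rule pair_graph_necklace)
  let ?z = "prod_encode (0, 0)"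
  have step: "prod_encode x \<rightarrow>\<^sup>*\<^bsub>necklace k\<^esub> ?z"
    if "x \<in> cells k" "y \<in> nbrs k x" "prod_encode y \<rightarrow>\<^sup>*\<^bsub>necklace k\<^esub> ?z" for x y
    using that by (meson adj_reachable_trans arc_necklace)
  have reach: "prod_encode (i, j) \<rightarrow>\<^sup>*\<^bsub>necklace k\<^esub> ?z" if "i < k" "j < length U" for i j
    using that
  proof (induction i arbitrary: j)
    case 0
    then show ?case
    proof (induction j rule: less_induct)
      case (less j)
      then have x: "(0, j) \<in> cells k" by (simp add: cells_def)
      show ?case
      proof (cases "j = 0")
        case True
        with x show ?thesis by (simp add: pverts_necklace)
      next
        case False
        then obtain v where v: "v \<in> set (U ! j)" "v < j" using descent less.prems by blast
        then have "(0, v) \<in> nbrs k (0, j)" by (simp add: nbrs_def)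
        moreover have "prod_encode (0, v) \<rightarrow>\<^sup>*\<^bsub>necklace k\<^esub> ?z"
          using less.prems v by (intro less.IH) auto
        ultimately show ?thesis
          using step[OF x] by blast
      qed
    qed
  next
    case (Suc i)
    from Suc.prems show ?case
    proof (induction j rule: less_induct)
      case (less j)
      then have x: "(Suc i, j) \<in> cells k" by (simp add: cells_def)
      show ?case
      proof (cases "j = 0")
        case True
        then have "(i, a) \<in> nbrs k (Suc i, j)" by (simp add: nbrs_def)
        moreover have "prod_encode (i, a) \<rightarrow>\<^sup>*\<^bsub>necklace k\<^esub> ?z"
          using Suc.IH less.prems port by simp
        ultimately show ?thesis
          using step[OF x] by blast
      next
        case False
        then obtain v where v: "v \<in> set (U ! j)" "v < j" using descent less.prems by blast
        then have "(Suc i, v) \<in> nbrs k (Suc i, j)" by (simp add: nbrs_def)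
        moreover have "prod_encode (Suc i, v) \<rightarrow>\<^sup>*\<^bsub>necklace k\<^esub> ?z"
          using less.prems v by (intro less.IH) auto
        ultimately show ?thesis
          using step[OF x] by blast
      qed
    qed
  qed
  have "strongly_connected (with_proj (necklace k))"
  proof (rule strongly_connectedI)
    show "verts (with_proj (necklace k)) \<noteq> {}"
      using assms port by (auto simp: pverts_necklace cells_def)
    fix x y assume xy: "x \<in> verts (with_proj (necklace k))" "y \<in> verts (with_proj (necklace k))"
    have to_z: "w \<rightarrow>\<^sup>*\<^bsub>necklace k\<^esub> ?z" if w: "w \<in> verts (with_proj (necklace k))" for w
    proof -
      obtain i j where "w = prod_encode (i, j)" "i < k" "j < length U"
        using w unfolding with_proj_simps pverts_necklace cells_def by blast
      then show ?thesis using reach by simp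
    qed
    show "x \<rightarrow>\<^sup>*\<^bsub>necklace k\<^esub> y"
      by (rule reachable_trans[OF to_z[OF xy(1)]
            symmetric_reachable[OF pair_sym_arcs to_z[OF xy(2)]]])
  qed
  then show ?thesis
    unfolding Digraph_Component.connected_def strongly_connected_def
      reachable_mk_symmetric_eq[OF pair_sym_arcs] by simp
qed

lemma closed_nbhd_necklace:
  assumes "i < k" "j < length U"
  shows "closed_nbhd (necklace k) (prod_encode (i, j))
       = prod_encode ` insert (i, j) (nbrs k (i, j))"
  using assms by (auto simp: closed_nbhd_def necklace_def cells_def)

lemma packing_number_necklace_ge: "k \<le> packing_number (necklace k)"
proof -
  let ?P = "(\<lambda>i. prod_encode (i, 1)) ` {..<k}"
  have "packing (necklace k) ?P"
    unfolding packing_iff[OF pair_graph_necklace]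
    using port by (auto simp: pverts_necklace cells_def closed_nbhd_necklace nbrs_def)
  then have "card ?P \<le> packing_number (necklace k)"
    by (rule packing_number_geI[OF pair_graph_necklace])
  then show ?thesis
    by (simp add: card_image inj_on_def)
qed

text \<open>
  A common closed neighbour within the unit is one in every copy, so each copy of a set from \<open>cs\<close>
  contains at most one vertex of a packing.
\<close>

lemma packing_number_necklace_le:
  assumes cover: "\<forall>j < length U. \<exists>c \<in> set cs. j \<in> set c"
    and clique: "\<forall>c \<in> set cs. \<forall>x \<in> set c. \<forall>y \<in> set c.
      x < length U \<and> (\<exists>z \<in> set (x # U ! x). z \<in> set (y # U ! y))"
  shows "packing_number (necklace k) \<le> k * length cs"
proof (rule packing_number_leI[OF pair_graph_necklace])
  fix P assume P: "packing (necklace k) P"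
  define cell where "cell i c = P \<inter> (\<lambda>j. prod_encode (i, j)) ` set c" for i c
  have disjoint: "closed_nbhd (necklace k) u \<inter> closed_nbhd (necklace k) v = {}"
    if "u \<in> P" "v \<in> P" "u \<noteq> v" for u v
    using P that unfolding packing_iff[OF pair_graph_necklace] by blast
  have card_cell: "card (cell i c) \<le> 1" if i: "i < k" and c: "c \<in> set cs" for i c
  proof -
    have "u = v" if uv: "u \<in> cell i c" "v \<in> cell i c" for u v
    proof (rule ccontr)
      assume "u \<noteq> v"
      obtain x y where xy: "u = prod_encode (i, x)" "v = prod_encode (i, y)" "x \<in> set c" "y \<in> set c"
        using uv unfolding cell_def by blast
      have len: "x < length U" "y < length U" using clique c xy by blast+
      obtain z where z: "z \<in> set (x # U ! x)" "z \<in> set (y # U ! y)"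
        using clique c xy by blast
      have "(i, z) \<in> insert (i, x) (nbrs k (i, x)) \<inter> insert (i, y) (nbrs k (i, y))"
        using z unfolding nbrs_def by auto
      then have "closed_nbhd (necklace k) u \<inter> closed_nbhd (necklace k) v \<noteq> {}"
        unfolding xy(1,2) closed_nbhd_necklace[OF i len(1)] closed_nbhd_necklace[OF i len(2)]
        by blast
      moreover have "u \<in> P" "v \<in> P" using uv unfolding cell_def by blast+
      ultimately show False using disjoint \<open>u \<noteq> v\<close> by blast
    qed
    moreover have "finite (cell i c)" unfolding cell_def by simp
    ultimately show ?thesis by (metis One_nat_def card_le_Suc0_iff_eq)
  qed
  have "P \<subseteq> (\<Union>i<k. \<Union>c \<in> set cs. cell i c)"
  proof
    fix u assume "u \<in> P"
    then obtain i j where u: "u = prod_encode (i, j)" "i < k" "j < length U"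
      using P unfolding packing_def pverts_necklace cells_def by blast
    moreover obtain c where "c \<in> set cs" "j \<in> set c" using cover u(3) by blast
    ultimately show "u \<in> (\<Union>i<k. \<Union>c \<in> set cs. cell i c)"
      using \<open>u \<in> P\<close> unfolding cell_def by blast
  qed
  then have "card P \<le> card (\<Union>i<k. \<Union>c \<in> set cs. cell i c)"
    by (intro card_mono) (simp_all add: cell_def)
  also have "\<dots> \<le> (\<Sum>i<k. card (\<Union>c \<in> set cs. cell i c))"
    by (intro card_UN_le) simp
  also have "\<dots> \<le> (\<Sum>i<k. \<Sum>c \<in> set cs. card (cell i c))"
    by (intro sum_mono card_UN_le) simp
  also have "\<dots> \<le> (\<Sum>i<k. \<Sum>c \<in> set cs. 1)"
    by (intro sum_mono card_cell) simp_all
  also have "\<dots> \<le> k * length cs"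
    by (simp add: card_length)
  finally show "card P \<le> k * length cs" .
qed

text \<open>
  An entry \<open>(S, R, g)\<close> of \<open>bs\<close> asserts that \<open>g\<close> vertices of \<open>S\<close> do not dominate \<open>R\<close>. The ports are
  excluded from \<open>R\<close> because they may be dominated from a neighbouring copy; they may lie in \<open>S\<close>, and
  the vertices of \<open>S - R\<close> may have neighbours anywhere. Hence the demands of disjoint sets \<open>S\<close> add up.
\<close>

lemma domination_number_necklace_ge:
  assumes disjoint: "distinct (concat (map fst bs))"
    and closed: "\<forall>(S, R, g) \<in> set bs. S \<noteq> [] \<and> (\<forall>v \<in> set R.
       v < length U \<and> v \<noteq> 0 \<and> v \<noteq> a \<and> v \<in> set S \<and> (\<forall>x \<in> set (U ! v). x \<in> set S))"
    and need: "\<forall>(S, R, g) \<in> set bs. \<forall>xs \<in> set (List.n_lists g S).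
       \<exists>v \<in> set R. \<forall>x \<in> set xs. x \<noteq> v \<and> x \<notin> set (U ! v)"
  shows "k * (\<Sum>(S, R, g) \<leftarrow> bs. Suc g) \<le> domination_number (necklace k)"
proof (rule domination_number_geI[OF pair_graph_necklace])
  fix D assume D: "dominating (necklace k) D"
  interpret pair_graph "necklace k" by (rule pair_graph_necklace)
  have "finite D"
    using D pair_finite_verts unfolding dominating_def by (blast intro: finite_subset)
  define T where "T i = {j. prod_encode (i, j) \<in> D} \<inter> set (concat (map fst bs))" for i
  have block: "Suc g \<le> card (T i \<inter> set S)" if i: "i < k" and b: "(S, R, g) \<in> set bs" for i S R g
  proof (rule ccontr)
    assume "\<not> ?thesis"
    then have "card (T i \<inter> set S) \<le> g" by simp
    moreover have "S \<noteq> []" using bspec[OF closed b] by simp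
    ultimately obtain xs where xs: "xs \<in> set (List.n_lists g S)" "T i \<inter> set S \<subseteq> set xs"
      using subset_n_lists[of "T i \<inter> set S" S g] by blast
    obtain v where v: "v \<in> set R" "\<forall>x \<in> set xs. x \<noteq> v \<and> x \<notin> set (U ! v)"
      using bspec[OF need b] xs(1) by auto
    have R: "v < length U" "v \<noteq> 0" "v \<noteq> a" "v \<in> set S" "set (U ! v) \<subseteq> set S"
      using bspec[OF closed b] v(1) by auto
    have "D \<inter> closed_nbhd (necklace k) (prod_encode (i, v)) \<noteq> {}"
      using D i R(1) unfolding dominating_def pverts_necklace cells_def by blast
    then obtain x where x: "x = v \<or> x \<in> set (U ! v)" "prod_encode (i, x) \<in> D"
      using R(2,3) unfolding closed_nbhd_necklace[OF i R(1)] by (auto simp: nbrs_def)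
    then have "x \<in> T i \<inter> set S"
      using R(4,5) b unfolding T_def by force
    with xs(2) v(2) x(1) show False by blast
  qed
  have unit: "(\<Sum>(S, R, g) \<leftarrow> bs. Suc g) \<le> card (T i)" if "i < k" for i
  proof -
    have "(\<Sum>(S, R, g) \<leftarrow> bs. Suc g) \<le> (\<Sum>(S, R, g) \<leftarrow> bs. card (T i \<inter> set S))"
      using block[OF that] by (intro sum_list_mono) auto
    also have "\<dots> = card (T i \<inter> set (concat (map fst bs)))"
      using sum_card_distinct_concat[OF disjoint, of "T i"] by (simp add: case_prod_unfold comp_def)
    finally show ?thesis by (simp add: T_def)
  qed
  have "k * (\<Sum>(S, R, g) \<leftarrow> bs. Suc g) = (\<Sum>i<k. \<Sum>(S, R, g) \<leftarrow> bs. Suc g)" by simp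
  also have "\<dots> \<le> (\<Sum>i<k. card (T i))" using unit by (intro sum_mono) simp
  also have "\<dots> = card (prod_encode ` (SIGMA i:{..<k}. T i))"
    by (simp add: card_image inj_on_def T_def)
  also have "\<dots> \<le> card D"
    using \<open>finite D\<close> by (intro card_mono) (auto simp: T_def)
  finally show "k * (\<Sum>(S, R, g) \<leftarrow> bs. Suc g) \<le> card D" .
qed

lemma limsup_ratio_necklaces:
  assumes cover: "\<forall>j < length U. \<exists>c \<in> set cs. j \<in> set c"
    and clique: "\<forall>c \<in> set cs. \<forall>x \<in> set c. \<forall>y \<in> set c.
      x < length U \<and> (\<exists>z \<in> set (x # U ! x). z \<in> set (y # U ! y))"
    and disjoint: "distinct (concat (map fst bs))"
    and closed: "\<forall>(S, R, g) \<in> set bs. S \<noteq> [] \<and> (\<forall>v \<in> set R.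
       v < length U \<and> v \<noteq> 0 \<and> v \<noteq> a \<and> v \<in> set S \<and> (\<forall>x \<in> set (U ! v). x \<in> set S))"
    and need: "\<forall>(S, R, g) \<in> set bs. \<forall>xs \<in> set (List.n_lists g S).
       \<exists>v \<in> set R. \<forall>x \<in> set xs. x \<noteq> v \<and> x \<notin> set (U ! v)"
    and member: "\<And>k. 2 \<le> k \<Longrightarrow> necklace k \<in> C"
  shows "ereal (real (\<Sum>(S, R, g) \<leftarrow> bs. Suc g) / real (length cs)) \<le> limsup_ratio C"
proof (rule limsup_ratio_geI)
  fix n :: nat
  let ?G = "necklace (max 2 n)" and ?k = "real (max 2 n)"
  let ?d = "real (\<Sum>(S, R, g) \<leftarrow> bs. Suc g)" and ?p = "real (length cs)"
  have "cs \<noteq> []" using cover port by force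
  have "real (packing_number ?G) \<le> ?k * ?p"
    using packing_number_necklace_le[OF cover clique] by (metis of_nat_le_iff of_nat_mult)
  then have "?d / ?p * real (packing_number ?G) \<le> ?d / ?p * (?k * ?p)"
    by (intro mult_left_mono) simp_all
  also have "\<dots> = ?k * ?d" using \<open>cs \<noteq> []\<close> by simp
  also have "\<dots> \<le> real (domination_number ?G)"
    using domination_number_necklace_ge[OF disjoint closed need] by (metis of_nat_le_iff of_nat_mult)
  finally have "?d / ?p * real (packing_number ?G) \<le> real (domination_number ?G)" .
  moreover have "n \<le> packing_number ?G"
    using packing_number_necklace_ge[of "max 2 n"] by simp
  moreover have "?G \<in> C" by (rule member) simp
  ultimately show "\<exists>G \<in> C. n \<le> packing_number G \<and>
      ?d / ?p * real (packing_number G) \<le> real (domination_number G)" by blast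
qed

end

section \<open>The two units\<close>

text \<open>
  \<open>K\<^sub>4\<close> on \<open>1, 2, 5, 6\<close> with the edges at \<open>1\<close> subdivided by \<open>0, 3, 4\<close>. The vertices \<open>0\<close> and \<open>3\<close> become
  the ports of the unit, and \<open>e\<close> is the neighbour of \<open>4\<close> outside.
\<close>

definition k4_block :: "nat \<Rightarrow> nat list list" where
  "k4_block e = [[1, 2], [0, 3, 4], [0, 5, 6], [1, 5], [1, 6, e], [2, 3, 6], [2, 4, 5]]"

text \<open>
  The Wagner graph is an 8-cycle with its four long diagonals. With \<open>s\<close> subtracted, the 8-cycle is
  \<open>1, 3, 7, 5, 2, 6, 8, 4\<close>, and its diagonal from \<open>1\<close> to \<open>2\<close> is subdivided by \<open>0\<close>, whose neighbour
  outside is \<open>e\<close>.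
\<close>

definition wagner_block :: "nat \<Rightarrow> nat \<Rightarrow> nat list list" where
  "wagner_block s e = (e # map ((+) s) [1, 2]) #
     map (map ((+) s)) [[0, 3, 4], [0, 5, 6], [1, 6, 7], [1, 5, 8], [2, 4, 7], [2, 3, 8],
       [3, 5, 8], [4, 6, 7]]"

text \<open>
  With \<open>s\<close> subtracted, this is \<open>K\<^sub>3\<^sub>,\<^sub>3\<close> with the parts \<open>1, 5, 6\<close> and \<open>2, 3, 4\<close>, whose edges from \<open>1\<close>
  to \<open>2\<close>, from \<open>5\<close> to \<open>3\<close> and from \<open>6\<close> to \<open>4\<close> are subdivided by \<open>0\<close>, \<open>7\<close> and \<open>8\<close>. The neighbours of
  these three vertices outside are \<open>e\<close>, \<open>f\<close> and \<open>g\<close>.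
\<close>

definition k33_block :: "nat \<Rightarrow> nat \<Rightarrow> nat \<Rightarrow> nat \<Rightarrow> nat list list" where
  "k33_block s e f g = (e # map ((+) s) [1, 2]) #
     map (map ((+) s)) [[0, 3, 4], [0, 5, 6], [1, 6, 7], [1, 5, 8], [2, 4, 7], [2, 3, 8]] @
     [f # map ((+) s) [3, 5], g # map ((+) s) [4, 6]]"

text \<open>
  Between the blocks stand the adjacency lists of \<open>r = 7\<close>, \<open>u = 8\<close>, \<open>v = 9\<close>, \<open>h = 10\<close> and the leaf
  \<open>l = 11\<close>.
\<close>

definition subcubic_unit :: "nat list list" where
  "subcubic_unit = k4_block 7
     @ [[4, 8, 9], [7, 10], [7, 11, 12], [8, 21, 30], [9]]
     @ wagner_block 12 9 @ wagner_block 21 10 @ wagner_block 30 10"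

text \<open>Here 16 and 17 are the vertices \<open>h\<close> of the two pairs of Wagner blocks.\<close>

definition cubic_unit :: "nat list list" where
  "cubic_unit = k4_block 7 @ k33_block 7 4 16 17
     @ [[14, 18, 27], [15, 36, 45]]
     @ wagner_block 18 16 @ wagner_block 27 16 @ wagner_block 36 17 @ wagner_block 45 17"

lemmas block_defs = k4_block_def wagner_block_def k33_block_def

lemmas subcubic_unit_eq = subcubic_unit_def[unfolded block_defs, simplified]

lemmas cubic_unit_eq = cubic_unit_def[unfolded block_defs, simplified]

text \<open>Rewriting expands a quantifier over an explicit list, so that the finite checks compute.\<close>

lemma all_less_iff: "(\<forall>j < n. P j) \<longleftrightarrow> (\<forall>j \<in> set [0..<n]. P j)"
  by auto

interpretation sub: unit_graph subcubic_unit 3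
proof
  show "\<forall>j < length subcubic_unit. \<forall>v \<in> set (subcubic_unit ! j).
      v < length subcubic_unit \<and> v \<noteq> j \<and> j \<in> set (subcubic_unit ! v)"
    unfolding all_less_iff by (simp add: subcubic_unit_eq)
  show "\<forall>j < length subcubic_unit. 0 < j \<longrightarrow> (\<exists>v \<in> set (subcubic_unit ! j). v < j)"
    unfolding all_less_iff by (simp add: subcubic_unit_eq)
qed (simp_all add: subcubic_unit_eq)

interpretation cub: unit_graph cubic_unit 3
proof
  show "\<forall>j < length cubic_unit. \<forall>v \<in> set (cubic_unit ! j).
      v < length cubic_unit \<and> v \<noteq> j \<and> j \<in> set (cubic_unit ! v)"
    unfolding all_less_iff by (simp add: cubic_unit_eq)
  show "\<forall>j < length cubic_unit. 0 < j \<longrightarrow> (\<exists>v \<in> set (cubic_unit ! j). v < j)"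
    unfolding all_less_iff by (simp add: cubic_unit_eq)
qed (simp_all add: cubic_unit_eq)

lemma subcubic_necklace:
  assumes "2 \<le> k"
  shows "sub.necklace k \<in> connected_subcubic_graphs"
proof -
  have deg: "\<forall>j < length subcubic_unit.
      card (set (subcubic_unit ! j)) + of_bool (j = 0) + of_bool (j = 3) \<le> (3 :: nat)"
    unfolding all_less_iff by (simp add: subcubic_unit_eq)
  have "out_degree (with_proj (sub.necklace k)) v \<le> 3" if "v \<in> pverts (sub.necklace k)" for v
    using that deg assms by (auto simp: sub.pverts_necklace sub.cells_def sub.out_degree_necklace)
  then show ?thesis
    using assms sub.pair_graph_necklace sub.connected_necklace
    by (simp add: connected_subcubic_graphs_def subcubic_def)
qed

lemma cubic_necklace:
  assumes "2 \<le> k"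
  shows "cub.necklace k \<in> connected_cubic_graphs"
proof -
  have deg: "\<forall>j < length cubic_unit.
      card (set (cubic_unit ! j)) + of_bool (j = 0) + of_bool (j = 3) = (3 :: nat)"
    unfolding all_less_iff by (simp add: cubic_unit_eq)
  have "out_degree (with_proj (cub.necklace k)) v = 3" if "v \<in> pverts (cub.necklace k)" for v
    using that deg assms by (auto simp: cub.pverts_necklace cub.cells_def cub.out_degree_necklace)
  then show ?thesis
    using assms cub.pair_graph_necklace cub.connected_necklace
    by (simp add: connected_cubic_graphs_def cubic_def)
qed

text \<open>
  The blocks 2 and 3 of \<open>?bs\<close> are the closed neighbourhoods of \<open>u = 8\<close> and of the leaf. The third
  components are the demands minus one: \<open>13 = 2 + 1 + 1 + 3 + 3 + 3\<close>.
\<close>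

lemma c_sub_ge: "ereal (13 / 6) \<le> c_sub"
proof -
  let ?cs = "[[0, 1, 2, 3, 4, 5, 6], [10, 8, 21, 30], [9, 7, 11, 12], [13..<21], [22..<30], [31..<39]]"
  let ?bs = "[([0, 1, 2, 3, 4, 5, 6], [1, 2, 5, 6], 1), ([7, 8, 10], [8], 0), ([9, 11], [11], 0),
    ([12..<21], [13..<21], 2), ([21..<30], [22..<30], 2), ([30..<39], [31..<39], 2)]"
  have "ereal (real (\<Sum>(S, R, g) \<leftarrow> ?bs. Suc g) / real (length ?cs)) \<le> c_sub"
    unfolding c_sub_def
  proof (rule sub.limsup_ratio_necklaces)
    show "\<forall>j < length subcubic_unit. \<exists>c \<in> set ?cs. j \<in> set c"
      unfolding all_less_iff by (simp add: subcubic_unit_eq)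
    show "\<forall>c \<in> set ?cs. \<forall>x \<in> set c. \<forall>y \<in> set c. x < length subcubic_unit \<and>
        (\<exists>z \<in> set (x # subcubic_unit ! x). z \<in> set (y # subcubic_unit ! y))"
      by (simp add: subcubic_unit_eq ex_disj_distrib)
    show "distinct (concat (map fst ?bs))"
      by simp
    show "\<forall>(S, R, g) \<in> set ?bs. S \<noteq> [] \<and> (\<forall>v \<in> set R. v < length subcubic_unit \<and>
        v \<noteq> 0 \<and> v \<noteq> 3 \<and> v \<in> set S \<and> (\<forall>x \<in> set (subcubic_unit ! v). x \<in> set S))"
      by (simp add: subcubic_unit_eq)
    show "\<forall>(S, R, g) \<in> set ?bs. \<forall>xs \<in> set (List.n_lists g S).
        \<exists>v \<in> set R. \<forall>x \<in> set xs. x \<noteq> v \<and> x \<notin> set (subcubic_unit ! v)"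
      by (simp add: subcubic_unit_eq numeral_2_eq_2)
  qed (rule subcubic_necklace)
  then show ?thesis by simp
qed

text \<open>
  The block \<open>[7..<18]\<close> consists of \<open>M\<close> and the two vertices 16 and 17, which may dominate the vertices
  14 and 15 of \<open>M\<close> from outside. These help no more than 14 and 15 would themselves, so that three
  vertices are needed nevertheless.
\<close>

lemma c_cub_ge: "ereal (17 / 8) \<le> c_cub"
proof -
  let ?cs = "[[0, 1, 2, 3, 4, 5, 6], [7..<14], [16, 14, 18, 27], [17, 15, 36, 45],
    [19..<27], [28..<36], [37..<45], [46..<54]]"
  let ?bs = "[([0, 1, 2, 3, 4, 5, 6], [1, 2, 5, 6], 1), ([7..<18], [8..<16], 2), ([18..<27], [19..<27], 2),
    ([27..<36], [28..<36], 2), ([36..<45], [37..<45], 2), ([45..<54], [46..<54], 2)]"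
  have "ereal (real (\<Sum>(S, R, g) \<leftarrow> ?bs. Suc g) / real (length ?cs)) \<le> c_cub"
    unfolding c_cub_def
  proof (rule cub.limsup_ratio_necklaces)
    show "\<forall>j < length cubic_unit. \<exists>c \<in> set ?cs. j \<in> set c"
      unfolding all_less_iff by (simp add: cubic_unit_eq)
    show "\<forall>c \<in> set ?cs. \<forall>x \<in> set c. \<forall>y \<in> set c. x < length cubic_unit \<and>
        (\<exists>z \<in> set (x # cubic_unit ! x). z \<in> set (y # cubic_unit ! y))"
      by (simp add: cubic_unit_eq ex_disj_distrib)
    show "distinct (concat (map fst ?bs))"
      by simp
    show "\<forall>(S, R, g) \<in> set ?bs. S \<noteq> [] \<and> (\<forall>v \<in> set R. v < length cubic_unit \<and>
        v \<noteq> 0 \<and> v \<noteq> 3 \<and> v \<in> set S \<and> (\<forall>x \<in> set (cubic_unit ! v). x \<in> set S))"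
      by (simp add: cubic_unit_eq)
    show "\<forall>(S, R, g) \<in> set ?bs. \<forall>xs \<in> set (List.n_lists g S).
        \<exists>v \<in> set R. \<forall>x \<in> set xs. x \<noteq> v \<and> x \<notin> set (cubic_unit ! v)"
      by (simp add: cubic_unit_eq numeral_2_eq_2)
  qed (rule cubic_necklace)
  then show ?thesis by simp
qed

theorem mainTheorem1:
  shows "c_sub \<ge> ereal (13 / 6) \<and> c_cub \<ge> ereal (17 / 8)"
  using c_sub_ge c_cub_ge by simp

end
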